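(* Let $S_1$ and $S_2$ be two finite $\Gamma$-labelled forests. Over the class of all finite $\tau^+$-structures, if $\mathscr{W}(S_1)\not\subseteq \mathscr{W}(S_2)$, then $\mathrm{FO}\{S_1\}\not\subseteq \mathrm{FO}\{S_2\}$.
   Context: $\tau^+=\langle U,R,B,r\rangle$ where $R,B$ are binary relation symbols, $U$ a unary relation symbol and $r$ a constant symbol. $\Gamma=\{\exists,\forall\}$. A $\Gamma$-labelled forest is a finite disjoint union of rooted directed trees (arcs from father to child), nodes labelled $\exists$ or $\forall$. $\mathscr{W}(S)\subseteq\Gamma^*$ is the set of words read off $S$: for each directed path $(v_0,\dots,v_n)$ ($n\ge0$) the word of labels of $v_0,\dots,v_n$, together with all subsequences of such words. Formulas are in negation normal form. The quantifier structure $qs(\varphi)$: literal $\mapsto$ empty forest; conjunction/disjunction $\mapsto$ disjoint union; $\exists x\,\theta$ (resp. $\forall x\,\theta$) $\mapsto$ new node labelled $\exists$ (resp. $\forall$) with an arc to every root of $qs(\theta)$. $S\preceq_e S'$ means there is a label-preserving, not necessarily injective map $\iota$ from nodes of $S$ to nodes of $S'$ such that each arc $x\to y$ in $S$ gives a directed path of length $\ge1$ from $\iota(x)$ to $\iota(y)$ in $S'$. $\mathrm{FO}\{S\}$ is the set of properties (isomorphism-closed classes within the class considered) definable on that class by a first-order sentence $\theta$ with $qs(\theta)\preceq_e S$; $\mathrm{FO}\{S_1\}\not\subseteq\mathrm{FO}\{S_2\}$ means some property definable with quantifier structure $\preceq_e S_1$ is not definable by any sentence with quantifier structure $\preceq_e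 S_2$. *)

theory Defs
  imports Main "HOL-Library.Sublist"
begin

datatype quant = QExists | QForall

datatype qtree = Node (root_label: quant) (children: "qtree list")

text \<open>
  A finite forest is represented by the list of its trees; the order of trees and of
  children is irrelevant to all notions below. A node is identified with its address,
  a nonempty list of indices leading to it from the top.
\<close>

type_synonym forest = "qtree list"

fun subtree_at :: "forest \<Rightarrow> nat list \<Rightarrow> qtree option" where
  "subtree_at S [] = None"
| "subtree_at S [i] = (if i < length S then Some (S ! i) else None)"
| "subtree_at S (i # j # p) =
     (if i < length S then subtree_at (children (S ! i)) (j # p) else None)"

definition nodes :: "forest \<Rightarrow> nat list set" where
  "nodes S = {p. subtree_at S p \<noteq> None}"

definition label :: "forest \<Rightarrow> nat list \<Rightarrow> quant" where
  "label S p = root_label (the (subtree_at S p))"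

definition arcs :: "forest \<Rightarrow> (nat list \<times> nat list) set" where
  "arcs S = {(p, q). p \<in> nodes S \<and> q \<in> nodes S \<and> (\<exists>i. q = p @ [i])}"

definition dipath :: "forest \<Rightarrow> nat list list \<Rightarrow> bool" where
  "dipath S vs \<longleftrightarrow> vs \<noteq> [] \<and> set vs \<subseteq> nodes S \<and>
     (\<forall>i. Suc i < length vs \<longrightarrow> (vs ! i, vs ! Suc i) \<in> arcs S)"

definition words :: "forest \<Rightarrow> quant list set" where
  "words S = {w. \<exists>vs. dipath S vs \<and> subseq w (map (label S) vs)}"

definition forest_emb :: "forest \<Rightarrow> forest \<Rightarrow> bool"  (infix \<open>\<preceq>\<^sub>e\<close> 50) where
  "S \<preceq>\<^sub>e S' \<longleftrightarrow> (\<exists>\<iota>.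
     (\<forall>x \<in> nodes S. \<iota> x \<in> nodes S' \<and> label S' (\<iota> x) = label S x) \<and>
     (\<forall>(x, y) \<in> arcs S. (\<iota> x, \<iota> y) \<in> (arcs S')\<^sup>+))"

datatype trm = Var nat | Root

datatype atom = Eq trm trm | UAtom trm | RAtom trm trm | BAtom trm trm

datatype fm =
    Pos atom
  | Neg atom
  | Conj fm fm
  | Disj fm fm
  | Exist nat fm
  | Forall nat fm

fun qs :: "fm \<Rightarrow> forest" where
  "qs (Pos a) = []"
| "qs (Neg a) = []"
| "qs (Conj \<phi> \<psi>) = qs \<phi> @ qs \<psi>"
| "qs (Disj \<phi> \<psi>) = qs \<phi> @ qs \<psi>"
| "qs (Exist x \<phi>) = [Node QExists (qs \<phi>)]"
| "qs (Forall x \<phi>) = [Node QForall (qs \<phi>)]"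

fun trms :: "atom \<Rightarrow> trm set" where
  "trms (Eq s t) = {s, t}"
| "trms (UAtom t) = {t}"
| "trms (RAtom s t) = {s, t}"
| "trms (BAtom s t) = {s, t}"

fun fv :: "fm \<Rightarrow> nat set" where
  "fv (Pos a) = {x. Var x \<in> trms a}"
| "fv (Neg a) = {x. Var x \<in> trms a}"
| "fv (Conj \<phi> \<psi>) = fv \<phi> \<union> fv \<psi>"
| "fv (Disj \<phi> \<psi>) = fv \<phi> \<union> fv \<psi>"
| "fv (Exist x \<phi>) = fv \<phi> - {x}"
| "fv (Forall x \<phi>) = fv \<phi> - {x}"

definition sentence :: "fm \<Rightarrow> bool" where
  "sentence \<phi> \<longleftrightarrow> fv \<phi> = {}"

record 'a struct =
  universe :: "'a set"
  relU :: "'a set"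
  relR :: "('a \<times> 'a) set"
  relB :: "('a \<times> 'a) set"
  cstr :: 'a

definition is_structure :: "'a struct \<Rightarrow> bool" where
  "is_structure A \<longleftrightarrow> relU A \<subseteq> universe A \<and> relR A \<subseteq> universe A \<times> universe A \<and>
     relB A \<subseteq> universe A \<times> universe A \<and> cstr A \<in> universe A"

definition finite_structures :: "'a struct set" where
  "finite_structures = {A. is_structure A \<and> finite (universe A)}"

definition isomorphic :: "'a struct \<Rightarrow> 'a struct \<Rightarrow> bool" where
  "isomorphic A B \<longleftrightarrow> (\<exists>h. bij_betw h (universe A) (universe B) \<and>
     (\<forall>x \<in> universe A. x \<in> relU A \<longleftrightarrow> h x \<in> relU B) \<and>
     (\<forall>x \<in> universe A. \<forall>y \<in> universe A. (x, y) \<in> relR A \<longleftrightarrow> (h x, h y) \<in> relR B) \<and>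
     (\<forall>x \<in> universe A. \<forall>y \<in> universe A. (x, y) \<in> relB A \<longleftrightarrow> (h x, h y) \<in> relB B) \<and>
     h (cstr A) = cstr B)"

fun eval_trm :: "'a struct \<Rightarrow> (nat \<Rightarrow> 'a) \<Rightarrow> trm \<Rightarrow> 'a" where
  "eval_trm A e (Var x) = e x"
| "eval_trm A e Root = cstr A"

fun sat_atom :: "'a struct \<Rightarrow> (nat \<Rightarrow> 'a) \<Rightarrow> atom \<Rightarrow> bool" where
  "sat_atom A e (Eq s t) \<longleftrightarrow> eval_trm A e s = eval_trm A e t"
| "sat_atom A e (UAtom t) \<longleftrightarrow> eval_trm A e t \<in> relU A"
| "sat_atom A e (RAtom s t) \<longleftrightarrow> (eval_trm A e s, eval_trm A e t) \<in> relR A"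
| "sat_atom A e (BAtom s t) \<longleftrightarrow> (eval_trm A e s, eval_trm A e t) \<in> relB A"

fun sat :: "'a struct \<Rightarrow> (nat \<Rightarrow> 'a) \<Rightarrow> fm \<Rightarrow> bool" where
  "sat A e (Pos a) \<longleftrightarrow> sat_atom A e a"
| "sat A e (Neg a) \<longleftrightarrow> \<not> sat_atom A e a"
| "sat A e (Conj \<phi> \<psi>) \<longleftrightarrow> sat A e \<phi> \<and> sat A e \<psi>"
| "sat A e (Disj \<phi> \<psi>) \<longleftrightarrow> sat A e \<phi> \<or> sat A e \<psi>"
| "sat A e (Exist x \<phi>) \<longleftrightarrow> (\<exists>a \<in> universe A. sat A (e(x := a)) \<phi>)"
| "sat A e (Forall x \<phi>) \<longleftrightarrow> (\<forall>a \<in> universe A. sat A (e(x := a)) \<phi>)"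

definition models :: "'a struct \<Rightarrow> fm \<Rightarrow> bool"  (infix \<open>\<Turnstile>\<close> 50) where
  "A \<Turnstile> \<phi> \<longleftrightarrow> (\<forall>e. (\<forall>x. e x \<in> universe A) \<longrightarrow> sat A e \<phi>)"

definition is_property :: "'a struct set \<Rightarrow> 'a struct set \<Rightarrow> bool" where
  "is_property C K \<longleftrightarrow> K \<subseteq> C \<and> (\<forall>A \<in> K. \<forall>B \<in> C. isomorphic A B \<longrightarrow> B \<in> K)"

definition FO :: "'a struct set \<Rightarrow> forest \<Rightarrow> 'a struct set set" where
  "FO C S = {K. is_property C K \<and>
     (\<exists>\<theta>. sentence \<theta> \<and> qs \<theta> \<preceq>\<^sub>e S \<and> K = {A \<in> C. A \<Turnstile> \<theta>})}"

text \<open>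
  Every finite structure is isomorphic to one whose domain is a set of natural numbers,
  so an isomorphism-closed class of finite structures is determined by its members
  over \<^typ>\<open>nat\<close>.
\<close>

abbreviation finite_tau_structures :: "nat struct set" where
  "finite_tau_structures \<equiv> finite_structures"

end

theory Submission
  imports Defs "HOL-Library.Countable"
begin

text \<open>
  For a word \<open>w\<close> consider finite trees with two kinds of edges \<open>R\<close> and \<open>B\<close>. A leaf at depth
  \<open>|w|\<close> is good if it is in \<open>U\<close>; an \<open>\<exists>\<close>-node is good if it has a good child along \<open>R\<close> and a
  good child along \<open>B\<close>; an \<open>\<forall>\<close>-node is good if all its \<open>R\<close>-children or all its \<open>B\<close>-children are
  good. As embeddings of quantifier structures need not be injective, \<open>the root is good\<close> is
  expressible with quantifier structure \<open>w\<close>.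

  Let all children occur in many copies and compare a tree with a good root with one with a bad
  root. Playing against a sentence that avoids \<open>w\<close>, Duplicator keeps a matching of
  prefix-closed sets of nodes in which good nodes may be matched with bad ones at depth \<open>i\<close>
  only after \<open>i\<close> letters of \<open>w\<close> have been played. A pick entering a good subtree is answered
  in a fresh bad subtree; since an \<open>\<exists>\<close>-node is bad as soon as one of its two sides has no good
  child, the defect can be placed on the side that the pick does not enter, and detecting it
  costs a further letter. Hence a single pick of a deep node gains nothing over picking its
  ancestors one by one.
\<close>

section \<open>Words along branches\<close>

text \<open>Paths from a root suffice, since every path extends upwards to one, and along them words
  follow the recursion on addresses. Indices are not checked against the length, so the value is
  meaningful only on \<open>nodes S\<close>.\<close>

fun branch :: "forest \<Rightarrow> nat list \<Rightarrow> quant list" where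
  "branch S [] = []"
| "branch S (i # p) = root_label (S ! i) # branch (children (S ! i)) p"

lemma Nil_notin_nodes [simp]: "[] \<notin> nodes S"
  by (simp add: nodes_def)

lemma singleton_in_nodes [simp]: "[i] \<in> nodes S \<longleftrightarrow> i < length S"
  by (simp add: nodes_def)

lemma Cons_Cons_in_nodes [simp]:
  "i # j # p \<in> nodes S \<longleftrightarrow> i < length S \<and> j # p \<in> nodes (children (S ! i))"
  by (simp add: nodes_def)

lemma nodes_butlast: "p @ [i] \<in> nodes S \<Longrightarrow> p \<noteq> [] \<Longrightarrow> p \<in> nodes S"
proof (induction p arbitrary: S)
  case (Cons a p)
  then show ?case by (cases p) auto
qed simp

lemma label_singleton: "i < length S \<Longrightarrow> label S [i] = root_label (S ! i)"
  by (simp add: label_def)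

lemma label_Cons_Cons:
  "i < length S \<Longrightarrow> label S (i # j # p) = label (children (S ! i)) (j # p)"
  by (simp add: label_def)

lemma branch_snoc: "p @ [i] \<in> nodes S \<Longrightarrow> branch S (p @ [i]) = branch S p @ [label S (p @ [i])]"
proof (induction p arbitrary: S)
  case Nil
  then show ?case by (simp add: label_singleton)
next
  case (Cons a p)
  then show ?case by (cases p) (auto simp: label_Cons_Cons)
qed

text \<open>An embedding turns an arc into a path of positive length; \<open>zs\<close> collects the
  labels passed on the way to its end.\<close>

lemma branch_trancl:
  "(x, y) \<in> (arcs S)\<^sup>+ \<Longrightarrow> \<exists>zs. branch S y = branch S x @ zs @ [label S y]"
proof (induction rule: trancl_induct)
  case (base y)
  then obtain i where "y = x @ [i]" "y \<in> nodes S" by (auto simp: arcs_def)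
  then show ?case by (auto simp: branch_snoc)
next
  case (step y z)
  then obtain i where "z = y @ [i]" "z \<in> nodes S" by (auto simp: arcs_def)
  then show ?case using step.IH by (auto simp: branch_snoc)
qed

lemma subseq_branch_in_words:
  assumes "p \<in> nodes S" "subseq w (branch S p)"
  shows "w \<in> words S"
proof -
  have "\<exists>vs. dipath S vs \<and> last vs = p \<and> map (label S) vs = branch S p"
    using assms(1)
  proof (induction p rule: rev_induct)
    case (snoc i p)
    show ?case
    proof (cases "p = []")
      case True
      then show ?thesis using snoc.prems
        by (intro exI[of _ "[[i]]"]) (auto simp: dipath_def label_singleton)
    next
      case False
      then have p: "p \<in> nodes S" using snoc.prems nodes_butlast by blast
      then obtain vs where vs: "dipath S vs" "last vs = p" "map (label S) vs = branch S p"
        using snoc.IH by blast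
      have "(p, p @ [i]) \<in> arcs S" using p snoc.prems by (auto simp: arcs_def)
      then have "dipath S (vs @ [p @ [i]])"
        using vs(1,2) snoc.prems unfolding dipath_def
        by (auto simp: nth_append last_conv_nth less_Suc_eq)
          (metis One_nat_def diff_Suc_1)
      then show ?thesis using vs(3) snoc.prems
        by (intro exI[of _ "vs @ [p @ [i]]"]) (auto simp: branch_snoc)
    qed
  qed simp
  then show ?thesis using assms(2) unfolding words_def by auto
qed

text \<open>Each arc of the source adds one letter to its branch, and the matching path in
  \<open>T\<close> adds a word ending in that letter.\<close>

lemma subseq_branch_emb:
  assumes emb: "\<And>x. x \<in> nodes S \<Longrightarrow> \<iota> x \<in> nodes T \<and> label T (\<iota> x) = label S x"
    and arc: "\<And>x y. (x, y) \<in> arcs S \<Longrightarrow> (\<iota> x, \<iota> y) \<in> (arcs T)\<^sup>+"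
  shows "p \<in> nodes S \<Longrightarrow> subseq (branch S p) (branch T (\<iota> p))"
proof (induction p rule: rev_induct)
  case (snoc i p)
  note e = emb[OF snoc.prems]
  show ?case
  proof (cases "p = []")
    case True
    \<comment> \<open>A root may be sent to an inner node; only the last letter of the branch to its
      image is used.\<close>
    obtain r j where "\<iota> (p @ [i]) = r @ [j]"
      using e by (metis Nil_notin_nodes rev_exhaust)
    then show ?thesis using True e snoc.prems
      by (auto simp: branch_snoc[of r j T] label_singleton intro: list_emb_append2)
  next
    case False
    then have p: "p \<in> nodes S" using snoc.prems nodes_butlast by blast
    then have "(p, p @ [i]) \<in> arcs S" using snoc.prems by (auto simp: arcs_def)
    from branch_trancl[OF arc[OF this]] obtain zs
      where "branch T (\<iota> (p @ [i])) = branch T (\<iota> p) @ zs @ [label T (\<iota> (p @ [i]))]"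
      by blast
    moreover have "branch S (p @ [i]) = branch S p @ [label S (p @ [i])]"
      using snoc.prems by (rule branch_snoc)
    moreover have "subseq [label S (p @ [i])] (zs @ [label S (p @ [i])])"
      by (rule list_emb_append2) simp
    ultimately show ?thesis
      using list_emb_append_mono[OF snoc.IH[OF p]] e by metis
  qed
qed simp

lemma nodes_append_left:
  "p \<in> nodes S \<Longrightarrow> p \<in> nodes (S @ T) \<and> branch (S @ T) p = branch S p"
  by (cases p rule: remdups_adj.cases) (auto simp: nth_append)

lemma nodes_append_right:
  "i # p \<in> nodes T \<Longrightarrow>
    (length S + i) # p \<in> nodes (S @ T) \<and> branch (S @ T) ((length S + i) # p) = branch T (i # p)"
  by (cases p) (auto simp: nth_append)

lemma nodes_Node:
  "p \<in> nodes S \<Longrightarrow> 0 # p \<in> nodes [Node q S] \<and> branch [Node q S] (0 # p) = q # branch S p"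
  by (cases p) auto

text \<open>Intended for a nonempty word \<open>w\<close>.\<close>

fun avoids :: "quant list \<Rightarrow> fm \<Rightarrow> bool" where
  "avoids w (Pos a) = True"
| "avoids w (Neg a) = True"
| "avoids w (Conj \<phi> \<psi>) = (avoids w \<phi> \<and> avoids w \<psi>)"
| "avoids w (Disj \<phi> \<psi>) = (avoids w \<phi> \<and> avoids w \<psi>)"
| "avoids w (Exist x \<phi>) =
    (if hd w = QExists then tl w \<noteq> [] \<and> avoids (tl w) \<phi> else avoids w \<phi>)"
| "avoids w (Forall x \<phi>) =
    (if hd w = QForall then tl w \<noteq> [] \<and> avoids (tl w) \<phi> else avoids w \<phi>)"

definition has_branch :: "forest \<Rightarrow> quant list \<Rightarrow> bool" where
  "has_branch S w \<longleftrightarrow> (\<exists>p \<in> nodes S. subseq w (branch S p))"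

lemma has_branch_append:
  "has_branch S w \<or> has_branch T w \<Longrightarrow> has_branch (S @ T) w"
  unfolding has_branch_def
  by (metis Nil_notin_nodes neq_Nil_conv nodes_append_left nodes_append_right)

lemma has_branch_Node:
  assumes "w \<noteq> []"
    and "if hd w = q then tl w = [] \<or> has_branch S (tl w) else has_branch S w"
  shows "has_branch [Node q S] w"
proof -
  obtain a v where w: "w = a # v" using assms(1) by (cases w) auto
  have root: "[0] \<in> nodes [Node q S]" "branch [Node q S] [0] = [q]" by auto
  have sub: "has_branch [Node q S] w" if "p \<in> nodes S" "subseq w (q # branch S p)" for p
    using that nodes_Node[of p S q] unfolding has_branch_def by metis
  show ?thesis
  proof (cases "a = q")
    case True
    then consider "v = []" | p where "p \<in> nodes S" "subseq v (branch S p)"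
      using assms(2) w by (auto simp: has_branch_def)
    then show ?thesis
    proof cases
      case 1
      then show ?thesis using root True w unfolding has_branch_def
        by (intro bexI[of _ "[0]"]) simp_all
    next
      case 2
      then show ?thesis using sub[of p] True w by simp
    qed
  next
    case False
    then show ?thesis using assms(2) w sub unfolding has_branch_def
      by (auto simp: list_emb_Cons)
  qed
qed

text \<open>\<open>avoids\<close> reads \<open>w\<close> greedily. If it fails, some chain of nested
  quantifiers uses up the last letter, and the quantifiers that removed letters spell
  \<open>w\<close> along a branch.\<close>

lemma not_avoids_has_branch: "w \<noteq> [] \<Longrightarrow> \<not> avoids w \<theta> \<Longrightarrow> has_branch (qs \<theta>) w"
proof (induction \<theta> arbitrary: w)
  case (Exist x \<theta>)
  then show ?case by (cases "tl w = []") (auto intro!: has_branch_Node split: if_splits)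
next
  case (Forall x \<theta>)
  then show ?case by (cases "tl w = []") (auto intro!: has_branch_Node split: if_splits)
qed (auto intro: has_branch_append)

text \<open>This replaces the condition on quantifier structures by one that can be followed through
  an induction on formulas.\<close>

lemma emb_avoids:
  assumes "qs \<theta> \<preceq>\<^sub>e S" "w \<noteq> []" "w \<notin> words S"
  shows "avoids w \<theta>"
proof (rule ccontr)
  assume "\<not> avoids w \<theta>"
  then obtain p where p: "p \<in> nodes (qs \<theta>)" "subseq w (branch (qs \<theta>) p)"
    using not_avoids_has_branch assms(2) unfolding has_branch_def by blast
  obtain \<iota> where \<iota>: "\<And>x. x \<in> nodes (qs \<theta>) \<Longrightarrow> \<iota> x \<in> nodes S \<and> label S (\<iota> x) = label (qs \<theta>) x"
    "\<And>x y. (x, y) \<in> arcs (qs \<theta>) \<Longrightarrow> (\<iota> x, \<iota> y) \<in> (arcs S)\<^sup>+"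
    using assms(1) unfolding forest_emb_def by fast
  have "subseq w (branch S (\<iota> p))"
    using subseq_branch_emb[OF \<iota> p(1)] p(2) subseq_order.order_trans by blast
  then show False using subseq_branch_in_words \<iota>(1) p(1) assms(3) by blast
qed


section \<open>The separating sentences\<close>

text \<open>\<open>t\<close> denotes the current node: \<open>Root\<close> at the start, afterwards
  the variable quantified last. \<open>k\<close> is meant to be fresh for \<open>t\<close>. The two
  sides share one level of quantifiers, so a letter costs nesting depth one.\<close>

fun game_fm :: "quant list \<Rightarrow> trm \<Rightarrow> nat \<Rightarrow> fm" where
  "game_fm [] t k = Pos (UAtom t)"
| "game_fm (QExists # v) t k =
    Conj (Exist k (Conj (Pos (RAtom t (Var k))) (game_fm v (Var k) (Suc k))))
         (Exist k (Conj (Pos (BAtom t (Var k))) (game_fm v (Var k) (Suc k))))"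
| "game_fm (QForall # v) t k =
    Disj (Forall k (Disj (Neg (RAtom t (Var k))) (game_fm v (Var k) (Suc k))))
         (Forall k (Disj (Neg (BAtom t (Var k))) (game_fm v (Var k) (Suc k))))"

lemma fv_game_fm: "fv (game_fm w t k) \<subseteq> {x. Var x = t}"
  by (induction w t k rule: game_fm.induct) auto

lemma sentence_game_fm: "sentence (game_fm w Root k)"
  using fv_game_fm[of w Root k] by (auto simp: sentence_def)

lemma qs_game_fm:
  "qs (game_fm (q # v) t k) = [Node q (qs (game_fm v (Var k) (Suc k))), Node q (qs (game_fm v (Var k) (Suc k)))]"
  by (cases q) auto

text \<open>All nodes of one level carry the same letter of \<open>w\<close>. Hence each level can
  be collapsed to a single node of a path.\<close>

lemma nodes_qs_game_fme_fm:
  "p \<in> nodes (qs (game_fm w t k)) \<Longrightarrow>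
    p \<noteq> [] \<and> length p \<le> length w \<and> label (qs (game_fm w t k)) p = w ! (length p - 1)"
proof (induction w arbitrary: p t k)
  case Nil
  then show ?case by (cases p rule: remdups_adj.cases) auto
next
  case (Cons q v)
  let ?S = "qs (game_fm v (Var k) (Suc k))"
  show ?case
  proof (cases p rule: remdups_adj.cases)
    case 1
    then show ?thesis using Cons.prems by simp
  next
    case (2 i)
    then have "i = 0 \<or> i = 1" using Cons.prems by (auto simp: qs_game_fm)
    then show ?thesis using 2 by (auto simp: qs_game_fm label_singleton)
  next
    case (3 i j r)
    then have i: "i < length (qs (game_fm (q # v) t k))" "i = 0 \<or> i = 1"
      using Cons.prems by (auto simp: qs_game_fm)
    then have ch: "children (qs (game_fm (q # v) t k) ! i) = ?S" by (auto simp: qs_game_fm)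
    then have "j # r \<in> nodes ?S" using Cons.prems 3 by simp
    from Cons.IH[OF this] show ?thesis using 3 i ch by (simp add: label_Cons_Cons)
  qed
qed

lemma subseq_index:
  "subseq xs ys \<Longrightarrow>
    \<exists>h. (\<forall>i j. i < j \<and> j < length xs \<longrightarrow> h i < (h j :: nat)) \<and>
        (\<forall>i < length xs. h i < length ys \<and> xs ! i = ys ! h i)"
proof (induction rule: list_emb.induct)
  case (list_emb_Nil ys)
  then show ?case by simp
next
  case (list_emb_Cons xs ys y)
  then obtain h where "\<forall>i j. i < j \<and> j < length xs \<longrightarrow> h i < (h j :: nat)"
    "\<forall>i < length xs. h i < length ys \<and> xs ! i = ys ! h i" by blast
  then show ?case by (intro exI[of _ "\<lambda>i. Suc (h i)"]) auto
next
  case (list_emb_Cons2 x y xs ys)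
  then obtain h where "\<forall>i j. i < j \<and> j < length xs \<longrightarrow> h i < (h j :: nat)"
    "\<forall>i < length xs. h i < length ys \<and> xs ! i = ys ! h i" by blast
  then show ?case using list_emb_Cons2
    by (intro exI[of _ "\<lambda>i. case i of 0 \<Rightarrow> 0 | Suc j \<Rightarrow> Suc (h j)"])
       (auto split: nat.splits simp: less_Suc_eq_0_disj)
qed

lemma dipath_trancl:
  assumes "dipath S vs" "i < j" "j < length vs"
  shows "(vs ! i, vs ! j) \<in> (arcs S)\<^sup>+"
  using assms(2,3)
proof (induction j)
  case (Suc j)
  then have "(vs ! j, vs ! Suc j) \<in> arcs S" using assms(1) by (auto simp: dipath_def)
  then show ?case using Suc by (cases "i = j") (auto intro: trancl_into_trancl)
qed simp

lemma game_fm_emb: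
  assumes "w \<in> words S"
  shows "qs (game_fm w t k) \<preceq>\<^sub>e S"
proof -
  obtain vs where vs: "dipath S vs" "subseq w (map (label S) vs)"
    using assms by (auto simp: words_def)
  obtain h where h: "\<forall>i j. i < j \<and> j < length w \<longrightarrow> h i < (h j :: nat)"
    "\<forall>i < length w. h i < length vs \<and> w ! i = map (label S) vs ! h i"
    using subseq_index[OF vs(2)] by auto
  let ?T = "qs (game_fm w t k)"
  \<comment> \<open>Addresses are nonempty, so levels are counted from 0 by
    \<open>length p - 1\<close>.\<close>
  define \<iota> where "\<iota> p = vs ! h (length p - 1)" for p :: "nat list"
  have "\<iota> x \<in> nodes S \<and> label S (\<iota> x) = label ?T x" if "x \<in> nodes ?T" for x
  proof -
    have "length x - 1 < length w" using nodes_qs_game_fme_fm[OF that]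
      by (cases x) auto
    then show ?thesis using nodes_qs_game_fme_fm[OF that] h(2) vs(1)
      by (auto simp: \<iota>_def dipath_def)
  qed
  moreover have "(\<iota> x, \<iota> y) \<in> (arcs S)\<^sup>+" if xy: "(x, y) \<in> arcs ?T" for x y
  proof -
    have n: "x \<in> nodes ?T" "y \<in> nodes ?T" "length y = Suc (length x)"
      using xy by (auto simp: arcs_def)
    then have "length x - 1 < length y - 1" "length y - 1 < length w"
      using nodes_qs_game_fme_fm[OF n(1)] nodes_qs_game_fme_fm[OF n(2)] by (cases x; auto)+
    then show ?thesis using dipath_trancl[OF vs(1)] h unfolding \<iota>_def by blast
  qed
  ultimately show ?thesis unfolding forest_emb_def by blast
qed

section \<open>The separating trees\<close>

text \<open>
  A node is addressed by the path leading to it from the root; a step consists of a side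
  (\<^term>\<open>True\<close> for the relation \<open>R\<close>, \<^term>\<open>False\<close> for \<open>B\<close>), the type of the child
  and a copy number. A node of type \<^term>\<open>None\<close> has children of all types on both sides,
  a node of type \<^term>\<open>Some c\<close> lacks on side \<open>c\<close> the children that would win the game
  for the player moving at it.
\<close>

type_synonym step = "bool \<times> bool option \<times> nat"
type_synonym address = "step list"

text \<open>The type decides the game. With \<open>None\<close> the mover has winning children on
  both sides, so an \<exists>-node is good and a \<forall>-node is bad; a defect reverses this. At a
  leaf, \<open>None\<close> stands for membership in \<open>U\<close>.\<close>

fun good :: "quant list \<Rightarrow> bool option \<Rightarrow> bool" where
  "good [] t = (t = None)"
| "good (q # v) t = (if q = QExists then t = None else t \<noteq> None)"

text \<open>The equation treats both quantifiers at once: on the defective side only bad children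
  remain below an \<exists>-node and only good ones below a \<forall>-node. \<open>M\<close> bounds
  the copy numbers.\<close>

fun valid :: "nat \<Rightarrow> quant list \<Rightarrow> bool option \<Rightarrow> address \<Rightarrow> bool" where
  "valid M w t [] = True"
| "valid M [] t (x # p) = False"
| "valid M (q # v) t ((c, t', m) # p) =
    (m < M \<and> (t = Some c \<longrightarrow> good v t' = (q = QForall)) \<and> valid M v t' p)"

definition ntype :: "bool option \<Rightarrow> address \<Rightarrow> bool option" where
  "ntype t p = (if p = [] then t else fst (snd (last p)))"

lemma ntype_simps [simp]:
  "ntype t [] = t"
  "ntype t (p @ [x]) = fst (snd x)"
  "ntype t (x # p) = ntype (fst (snd x)) p"
  by (auto simp: ntype_def)

lemma ntype_append [simp]: "ntype t (p @ r) = ntype (ntype t p) r"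
  by (auto simp: ntype_def)

lemma valid_append:
  "valid M w t (p @ r) \<longleftrightarrow> valid M w t p \<and> valid M (drop (length p) w) (ntype t p) r"
  by (induction M w t p rule: valid.induct) (auto simp: ntype_def)

lemma valid_length: "valid M w t p \<Longrightarrow> length p \<le> length w"
  by (induction M w t p rule: valid.induct) auto

lemma valid_take: "valid M w t r \<Longrightarrow> valid M w t (take k r)"
  by (metis append_take_drop_id valid_append)

text \<open>Atoms do not see the types of inner nodes, which show only in the children that exist;
  types become visible through \<open>U\<close> at full depth.\<close>

definition tree :: "nat \<Rightarrow> quant list \<Rightarrow> bool option \<Rightarrow> address struct" where
  "tree M w t = \<lparr>universe = {p. valid M w t p},
     relU = {p. valid M w t p \<and> length p = length w \<and> ntype t p = None},
     relR = {(p, r). valid M w t r \<and> (\<exists>x. r = p @ [x] \<and> fst x)},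
     relB = {(p, r). valid M w t r \<and> (\<exists>x. r = p @ [x] \<and> \<not> fst x)},
     cstr = []\<rparr>"

lemma tree_simps [simp]:
  "universe (tree M w t) = {p. valid M w t p}"
  "relU (tree M w t) = {p. valid M w t p \<and> length p = length w \<and> ntype t p = None}"
  "relR (tree M w t) = {(p, r). valid M w t r \<and> (\<exists>x. r = p @ [x] \<and> fst x)}"
  "relB (tree M w t) = {(p, r). valid M w t r \<and> (\<exists>x. r = p @ [x] \<and> \<not> fst x)}"
  "cstr (tree M w t) = []"
  by (simp_all add: tree_def)

lemma finite_valid: "finite {p. valid M w t p}"
proof -
  have "set p \<subseteq> UNIV \<times> UNIV \<times> {..<M}" if "valid M w t p" for p
    using that by (induction M w t p rule: valid.induct) auto
  then have "{p. valid M w t p} \<subseteq> {p. set p \<subseteq> UNIV \<times> UNIV \<times> {..<M} \<and> length p \<le> length w}"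
    using valid_length by blast
  moreover have "finite {p. set p \<subseteq> (UNIV :: bool set) \<times> (UNIV :: bool option set) \<times> {..<M} \<and> length p \<le> length w}"
    by (intro finite_lists_length_le) auto
  ultimately show ?thesis by (rule finite_subset)
qed

lemma tree_finite_structure: "tree M w t \<in> finite_structures"
  using finite_valid by (auto simp: finite_structures_def is_structure_def valid_append)

lemma ex_good: "\<exists>t. good v t = b"
  by (cases v; cases b) (auto split: if_splits intro: exI[of _ None] exI[of _ "Some True"])

text \<open>An unrestricted side has good and bad children, a defective one only children that lose
  for the mover; so the type of \<open>p\<close> settles each letter.\<close>

lemma sat_game_fm:
  assumes "M > 0"
  shows "valid M w t0 p \<Longrightarrow> v = drop (length p) w \<Longrightarrow> eval_trm (tree M w t0) e t = p \<Longrightarrow>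
    (\<And>x. t = Var x \<Longrightarrow> x < k) \<Longrightarrow> sat (tree M w t0) e (game_fm v t k) \<longleftrightarrow> good v (ntype t0 p)"
proof (induction v arbitrary: p e t k)
  case Nil
  then show ?case using valid_length[of M w t0 p] by auto
next
  case (Cons q v)
  let ?T = "tree M w t0"
  \<comment> \<open>Since \<open>t\<close> is \<open>Root\<close> or a variable below
    \<open>k\<close>, reassigning \<open>k\<close> does not change its value.\<close>
  have ev: "eval_trm ?T (e(k := r)) t = p" for r
    using Cons.prems(3,4) by (cases t) auto
  have dr: "drop (length p) w = q # v" using Cons.prems by simp
  then have v: "v = drop (Suc (length p)) w"
    by (metis drop_Suc list.sel(3) tl_drop)
  have child: "valid M w t0 (p @ [(c, t', m)]) \<longleftrightarrow>
      m < M \<and> (ntype t0 p = Some c \<longrightarrow> good v t' = (q = QForall))" for c t' m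
    using Cons.prems(1) by (simp add: valid_append dr)
  have IH: "sat ?T (e(k := p @ [x])) (game_fm v (Var k) (Suc k)) \<longleftrightarrow> good v (fst (snd x))"
    if "valid M w t0 (p @ [x])" for x
  proof -
    have "sat ?T (e(k := p @ [x])) (game_fm v (Var k) (Suc k)) \<longleftrightarrow> good v (ntype t0 (p @ [x]))"
      using that v by (intro Cons.IH) simp_all
    then show ?thesis by simp
  qed
  have exR: "sat ?T e (Exist k (Conj (Pos (RAtom t (Var k))) (game_fm v (Var k) (Suc k))))
      \<longleftrightarrow> (\<exists>x. valid M w t0 (p @ [x]) \<and> fst x \<and> good v (fst (snd x)))"
    by (simp add: ev del: split_paired_Ex split_paired_All) (metis IH)
  have exB: "sat ?T e (Exist k (Conj (Pos (BAtom t (Var k))) (game_fm v (Var k) (Suc k))))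
      \<longleftrightarrow> (\<exists>x. valid M w t0 (p @ [x]) \<and> \<not> fst x \<and> good v (fst (snd x)))"
    by (simp add: ev del: split_paired_Ex split_paired_All) (metis IH)
  have allR: "sat ?T e (Forall k (Disj (Neg (RAtom t (Var k))) (game_fm v (Var k) (Suc k))))
      \<longleftrightarrow> (\<forall>x. valid M w t0 (p @ [x]) \<and> fst x \<longrightarrow> good v (fst (snd x)))"
    by (simp add: ev del: split_paired_Ex split_paired_All) (metis IH)
  have allB: "sat ?T e (Forall k (Disj (Neg (BAtom t (Var k))) (game_fm v (Var k) (Suc k))))
      \<longleftrightarrow> (\<forall>x. valid M w t0 (p @ [x]) \<and> \<not> fst x \<longrightarrow> good v (fst (snd x)))"
    by (simp add: ev del: split_paired_Ex split_paired_All) (metis IH)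
  obtain g b where gb: "good v g" "\<not> good v b" using ex_good[of v] by metis
  show ?case
  proof (cases q)
    case QExists
    \<comment> \<open>The two conjuncts are merged into one quantifier over the side
      \<open>c\<close>.\<close>
    then have "sat ?T e (game_fm (q # v) t k) \<longleftrightarrow>
      (\<forall>c. \<exists>t' m. valid M w t0 (p @ [(c, t', m)]) \<and> good v t')"
      using exR exB by (simp add: all_bool_eq ex_bool_eq conj_commute del: sat.simps(5))
    also have "\<dots> \<longleftrightarrow> ntype t0 p = None"
      using QExists gb assms unfolding child by (cases "ntype t0 p") auto
    finally show ?thesis using QExists by simp
  next
    case QForall
    then have "sat ?T e (game_fm (q # v) t k) \<longleftrightarrow>
      (\<exists>c. \<forall>t' m. valid M w t0 (p @ [(c, t', m)]) \<longrightarrow> good v t')"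
      using allR allB by (simp add: ex_bool_eq all_bool_eq disj_commute del: sat.simps(6))
    also have "\<dots> \<longleftrightarrow> ntype t0 p \<noteq> None"
      using QForall gb assms unfolding child by (cases "ntype t0 p") auto
    finally show ?thesis using QForall by simp
  qed
qed


section \<open>Matchings of trees\<close>

text \<open>A partial isomorphism between prefix-closed sets of nodes, respecting parents and sides.
  Types are deliberately not compared; \<open>tolerable\<close> controls how they may
  differ.\<close>

definition matching ::
  "nat \<Rightarrow> quant list \<Rightarrow> bool option \<Rightarrow> bool option \<Rightarrow> (address \<times> address) set \<Rightarrow> bool" where
  "matching M w t\<^sub>1 t\<^sub>2 G \<longleftrightarrow> ([], []) \<in> G \<and>
     (\<forall>(p, p') \<in> G. valid M w t\<^sub>1 p \<and> valid M w t\<^sub>2 p' \<and> length p = length p' \<and>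
        (p \<noteq> [] \<longrightarrow> (butlast p, butlast p') \<in> G \<and> fst (last p) = fst (last p'))) \<and>
     (\<forall>(p, p') \<in> G. \<forall>(r, r') \<in> G. p = r \<longleftrightarrow> p' = r')"

text \<open>
  Only winning nodes may be matched with losing ones, and at depth \<open>i\<close> only after at least
  \<open>i\<close> letters of \<open>w\<close> have been used up. The flag \<open>g\<close> allows the same argument to serve
  both players.
\<close>

definition tolerable ::
  "bool \<Rightarrow> nat \<Rightarrow> quant list \<Rightarrow> bool option \<Rightarrow> bool option \<Rightarrow> (address \<times> address) set \<Rightarrow> bool" where
  "tolerable g n w t\<^sub>1 t\<^sub>2 G \<longleftrightarrow> (\<forall>(p, p') \<in> G. ntype t\<^sub>1 p \<noteq> ntype t\<^sub>2 p' \<longrightarrow>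
     good (drop (length p) w) (ntype t\<^sub>1 p) = g \<and>
     good (drop (length p) w) (ntype t\<^sub>2 p') = (\<not> g) \<and> n + length p \<le> length w)"

lemma matchingD:
  assumes "matching M w t\<^sub>1 t\<^sub>2 G" "(p, p') \<in> G"
  shows "valid M w t\<^sub>1 p" "valid M w t\<^sub>2 p'" "length p = length p'"
    "p \<noteq> [] \<Longrightarrow> (butlast p, butlast p') \<in> G" "p \<noteq> [] \<Longrightarrow> fst (last p) = fst (last p')"
    "(r, r') \<in> G \<Longrightarrow> p = r \<longleftrightarrow> p' = r'"
  using assms unfolding matching_def by blast+

lemma matching_converse:
  assumes "matching M w t\<^sub>1 t\<^sub>2 G"
  shows "matching M w t\<^sub>2 t\<^sub>1 (G\<inverse>)"
proof -
  have "([], []) \<in> G\<inverse>" using assms by (simp add: matching_def)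
  moreover have "valid M w t\<^sub>2 p \<and> valid M w t\<^sub>1 p' \<and> length p = length p' \<and>
      (p \<noteq> [] \<longrightarrow> (butlast p, butlast p') \<in> G\<inverse> \<and> fst (last p) = fst (last p'))"
    if "(p, p') \<in> G\<inverse>" for p p'
    using matchingD[OF assms, of p' p] that by (cases "p' = []") auto
  moreover have "p = r \<longleftrightarrow> p' = r'" if "(p, p') \<in> G\<inverse>" "(r, r') \<in> G\<inverse>" for p p' r r'
    using matchingD(6)[OF assms, of p' p r' r] that by auto
  ultimately show ?thesis unfolding matching_def by blast
qed

lemma tolerable_iff:
  "tolerable g n w t\<^sub>1 t\<^sub>2 G \<longleftrightarrow> (\<forall>p p'. (p, p') \<in> G \<longrightarrow> ntype t\<^sub>1 p \<noteq> ntype t\<^sub>2 p' \<longrightarrow>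
     good (drop (length p) w) (ntype t\<^sub>1 p) = g \<and>
     good (drop (length p) w) (ntype t\<^sub>2 p') = (\<not> g) \<and> n + length p \<le> length w)"
  unfolding tolerable_def by blast

text \<open>Swapping the trees exchanges good and bad in every mismatch. Picks in the second tree
  thus reduce to picks in the first.\<close>

lemma tolerable_converse:
  assumes "matching M w t\<^sub>1 t\<^sub>2 G" "tolerable g n w t\<^sub>1 t\<^sub>2 G"
  shows "tolerable (\<not> g) n w t\<^sub>2 t\<^sub>1 (G\<inverse>)"
  unfolding tolerable_iff
proof (intro allI impI)
  fix p' p
  assume "(p', p) \<in> G\<inverse>" "ntype t\<^sub>2 p' \<noteq> ntype t\<^sub>1 p"
  then have G: "(p, p') \<in> G" "ntype t\<^sub>1 p \<noteq> ntype t\<^sub>2 p'" by auto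
  then have "good (drop (length p) w) (ntype t\<^sub>1 p) = g \<and>
      good (drop (length p) w) (ntype t\<^sub>2 p') = (\<not> g) \<and> n + length p \<le> length w"
    using assms(2) unfolding tolerable_iff by blast
  then show "good (drop (length p') w) (ntype t\<^sub>2 p') = (\<not> g) \<and>
    good (drop (length p') w) (ntype t\<^sub>1 p) = (\<not> \<not> g) \<and> n + length p' \<le> length w"
    using matchingD(3)[OF assms(1) G(1)] by simp
qed

lemma tolerable_mono:
  assumes "tolerable g n w t\<^sub>1 t\<^sub>2 G" "m \<le> n"
  shows "tolerable g m w t\<^sub>1 t\<^sub>2 G"
  using assms unfolding tolerable_iff by (meson add_le_mono1 order_trans)

lemma matching_prefix: "matching M w t\<^sub>1 t\<^sub>2 G \<Longrightarrow> p @ r \<in> Domain G \<Longrightarrow> p \<in> Domain G"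
proof (induction r rule: rev_induct)
  case (snoc x r)
  then obtain z where "(p @ r @ [x], z) \<in> G" by auto
  then have "(butlast (p @ r @ [x]), butlast z) \<in> G"
    using snoc.prems(1) unfolding matching_def by blast
  then show ?case using snoc by (simp add: butlast_append Domain.DomainI)
qed simp

text \<open>\<open>p\<close> is a place where \<open>a\<close> leaves \<open>D\<close>. For a
  prefix-closed \<open>D\<close>, such as the domain of a matching, it is the longest prefix of
  \<open>a\<close> in \<open>D\<close>.\<close>

lemma longest_prefix:
  assumes "[] \<in> D"
  obtains p r where "a = p @ r" "p \<in> D" "\<And>x r'. r = x # r' \<Longrightarrow> p @ [x] \<notin> D"
proof -
  have "\<exists>p r. a = p @ r \<and> p \<in> D \<and> (\<forall>x r'. r = x # r' \<longrightarrow> p @ [x] \<notin> D)"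
  proof (induction a rule: rev_induct)
    case Nil
    then show ?case using assms by auto
  next
    case (snoc y a)
    then obtain p r where *: "a = p @ r" "p \<in> D" "\<forall>x r'. r = x # r' \<longrightarrow> p @ [x] \<notin> D" by blast
    show ?case
    proof (cases r)
      case Nil
      show ?thesis
      proof (cases "a @ [y] \<in> D")
        case True
        then show ?thesis by (intro exI[of _ "a @ [y]"] exI[of _ "[]"]) auto
      next
        case False
        then show ?thesis using * Nil by (intro exI[of _ a] exI[of _ "[y]"]) auto
      qed
    next
      case (Cons x r')
      then show ?thesis using * by (intro exI[of _ p] exI[of _ "r @ [y]"]) auto
    qed
  qed
  then show ?thesis using that by blast
qed

text \<open>The type at the top restricts only the first step, and only on the defective
  side.\<close>

lemma valid_change_type:
  "valid M v t r \<Longrightarrow> (\<And>c t' m r'. r = (c, t', m) # r' \<Longrightarrow> s \<noteq> Some c) \<Longrightarrow> valid M v s r"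
  by (cases r; cases v) auto

text \<open>The unread part of the word after one quantifier, in step with the clauses of
  \<open>avoids\<close>.\<close>

definition spent :: "quant \<Rightarrow> quant list \<Rightarrow> quant list" where
  "spent q \<sigma> = (if hd \<sigma> = q then tl \<sigma> else \<sigma>)"

lemma length_spent_le: "length (spent q \<sigma>) \<le> length \<sigma>"
  by (simp add: spent_def)

text \<open>
  When the pick enters a subtree below a node where the two types differ, the answering subtree
  gets the opposite value; if its root has to lack children, it does so on the side where the
  pick does not continue.
\<close>

lemma matching_extend:
  assumes G: "matching M w t\<^sub>1 t\<^sub>2 G" "finite G" "card G < M"
    and tol: "tolerable g (length \<sigma>) w t\<^sub>1 t\<^sub>2 G"
    and \<sigma>: "\<sigma> = drop k w" "spent (if g then QExists else QForall) \<sigma> \<noteq> []"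
    and a: "valid M w t\<^sub>1 a"
  shows "\<exists>G' a'. G \<subseteq> G' \<and> (a, a') \<in> G' \<and> matching M w t\<^sub>1 t\<^sub>2 G' \<and> finite G' \<and>
    card G' \<le> card G + length w \<and>
    tolerable g (length (spent (if g then QExists else QForall) \<sigma>)) w t\<^sub>1 t\<^sub>2 G'"
proof -
  define \<sigma>' where "\<sigma>' = spent (if g then QExists else QForall) \<sigma>"
  have \<sigma>': "\<sigma>' \<noteq> []" using \<sigma>(2) by (simp add: \<sigma>'_def)
  have tol': "tolerable g (length \<sigma>') w t\<^sub>1 t\<^sub>2 G"
    using tolerable_mono[OF tol] length_spent_le by (simp add: \<sigma>'_def)
  have "[] \<in> Domain G" using G(1) by (auto simp: matching_def)
  then obtain p s where ps: "a = p @ s" "p \<in> Domain G" "\<And>x r. s = x # r \<Longrightarrow> p @ [x] \<notin> Domain G"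
    by (rule longest_prefix) blast
  obtain p' where p': "(p, p') \<in> G" using ps(2) by blast
  have len: "length p = length p'" and vp': "valid M w t\<^sub>2 p'"
    using G(1) p' unfolding matching_def by blast+
  show ?thesis
  proof (cases s)
    case Nil
    then show ?thesis using G p' tol' ps(1) \<sigma>'_def by (intro exI[of _ G]) auto
  next
    case (Cons x r)
    obtain c \<tau> m where x: "x = (c, \<tau>, m)" by (cases x)
    define i where "i = length p"
    have va: "valid M (drop i w) (ntype t\<^sub>1 p) ((c, \<tau>, m) # r)"
      using a ps(1) Cons x by (simp add: valid_append i_def)
    then obtain q v where w: "drop i w = q # v" by (cases "drop i w") auto
    have v: "v = drop (Suc i) w" using w by (metis drop_Suc list.sel(3) tl_drop)
    have lw: "length w = i + Suc (length v)"
      using w by (metis add.commute length_Cons length_drop less_imp_le_nat linorder_not_less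
          le_add_diff_inverse drop_eq_Nil list.distinct(1))
    have ok1: "ntype t\<^sub>1 p = Some c \<longrightarrow> good v \<tau> = (q = QForall)" "valid M v \<tau> r"
      using va w by auto
    \<comment> \<open>The demands on the type \<tau>' of the answering child: it may occur below
      \<open>p'\<close>, the rest \<open>r\<close> of the path can be copied below it, and a
      mismatch with \<tau> is tolerable.\<close>
    define cont where "cont \<tau>' \<longleftrightarrow> (ntype t\<^sub>2 p' = Some c \<longrightarrow> good v \<tau>' = (q = QForall)) \<and>
      valid M v \<tau>' r \<and> (\<tau> \<noteq> \<tau>' \<longrightarrow>
        good v \<tau> = g \<and> good v \<tau>' = (\<not> g) \<and> length \<sigma>' + Suc i \<le> length w)" for \<tau>'
    have "\<exists>\<tau>'. cont \<tau>'"
    proof (cases "ntype t\<^sub>2 p' = Some c \<longrightarrow> good v \<tau> = (q = QForall)")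
      case True
      then show ?thesis using ok1 unfolding cont_def by blast
    next
      case False
      \<comment> \<open>Copying \<tau> is blocked by a defect of \<open>p'\<close> on side
        \<open>c\<close> that \<open>p\<close> does not share, so \<open>p\<close> and
        \<open>p'\<close> are already mismatched.\<close>
      then have t2: "ntype t\<^sub>2 p' = Some c" and g\<tau>: "good v \<tau> \<noteq> (q = QForall)" by auto
      then have "ntype t\<^sub>1 p \<noteq> ntype t\<^sub>2 p'" using ok1 by auto
      then have dev: "good (q # v) (ntype t\<^sub>2 p') = (\<not> g)" "length \<sigma> + i \<le> length w"
        using tol p' w unfolding tolerable_def i_def by auto
      \<comment> \<open>A defective node is bad for \<exists> and good for \<forall>, so the flag
        determines the letter at depth \<open>i\<close>: it is the quantifier being played.\<close>
      have q: "q = (if g then QExists else QForall)"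
        using dev(1) t2 by (cases q) auto
      \<comment> \<open>The mismatch descends to depth \<open>Suc i\<close>. If
        \<open>i = k\<close>, the pick uses up the head \<open>q\<close> of \<sigma>; otherwise
        \<open>i < k\<close>, and the old bound has room for one more level.\<close>
      have sl: "length \<sigma>' + Suc i \<le> length w"
      proof (cases "k = i")
        case True
        then show ?thesis using \<sigma>(1) w q lw by (simp add: \<sigma>'_def spent_def)
      next
        case False
        have "\<sigma> \<noteq> []" using \<sigma>' by (auto simp: \<sigma>'_def spent_def)
        then have "k < length w" "length \<sigma> = length w - k" using \<sigma>(1) by auto
        then have "i < k" using dev(2) False by linarith
        then have "length \<sigma> + Suc i \<le> length w" using \<open>k < length w\<close> \<open>length \<sigma> = length w - k\<close>
          by linarith
        then show ?thesis using length_spent_le[of _ \<sigma>] unfolding \<sigma>'_def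
          by (meson add_le_mono1 order_trans)
      qed
      then have "v \<noteq> []" using \<sigma>' lw by (cases \<sigma>') auto
      then obtain q' v' where v': "v = q' # v'" by (cases v) auto
      have g\<tau>': "good v \<tau> = g" using g\<tau> q by (cases g) auto
      have "\<exists>\<tau>'. good v \<tau>' = (\<not> g) \<and> valid M v \<tau>' r"
      proof (cases "good v None = g")
        case True
        \<comment> \<open>The defect is put on the side that \<open>r\<close> does not enter; for
          empty \<open>r\<close> the choice is arbitrary.\<close>
        define d where "d = (case r of [] \<Rightarrow> True | y # _ \<Rightarrow> \<not> fst y)"
        have "valid M v (Some d) r"
          using ok1(2) by (rule valid_change_type) (auto simp: d_def)
        moreover have "good v (Some d) = (\<not> g)" using True v' by auto
        ultimately show ?thesis by blast
      next
        case False
        moreover have "valid M v None r" using ok1(2) by (rule valid_change_type) auto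
        ultimately show ?thesis by blast
      qed
      then obtain \<tau>' where "good v \<tau>' = (\<not> g)" "valid M v \<tau>' r" by blast
      then show ?thesis using g\<tau>' sl q unfolding cont_def by (intro exI[of _ \<tau>']) (cases g; auto)
    qed
    then obtain \<tau>' where \<tau>': "cont \<tau>'" by blast
    \<comment> \<open>Pigeonhole: there are \<open>M\<close> copies of the answering child and fewer
      than \<open>M\<close> matched nodes.\<close>
    have "card (Range G) < M"
      using G(2,3) card_image_le[of G snd] by (simp add: Range_snd)
    moreover have "card ((\<lambda>m'. p' @ [(c, \<tau>', m')]) ` {..<M}) = M"
      by (simp add: card_image inj_on_def)
    ultimately have "\<not> (\<lambda>m'. p' @ [(c, \<tau>', m')]) ` {..<M} \<subseteq> Range G"
      using card_mono[OF finite_Range[OF G(2)]] by (metis linorder_not_less)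
    then obtain m' where m': "m' < M" "p' @ [(c, \<tau>', m')] \<notin> Range G" by blast
    \<comment> \<open>The new pairs run down the path from below \<open>p\<close> to
      \<open>a\<close>. The remainder \<open>r\<close> is copied literally, so only the pair with
      \<open>j = 0\<close> can differ in type.\<close>
    define f where "f j = (p @ x # take j r, p' @ (c, \<tau>', m') # take j r)" for j
    define G' where "G' = G \<union> f ` {..length r}"
    have vf1: "valid M w t\<^sub>1 (fst (f j))" for j
      using a ps(1) Cons valid_take[of M w t\<^sub>1 a "length p + Suc j"] by (simp add: f_def)
    have vf2: "valid M w t\<^sub>2 (snd (f j))" for j
      using \<tau>' m'(1) vp' len w valid_take[of M v \<tau>' r j]
      by (simp add: f_def valid_append i_def cont_def)
    have fresh1: "fst (f j) \<notin> Domain G" for j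
      using matching_prefix[OF G(1), of "p @ [x]" "take j r"] ps(3)[OF Cons] by (auto simp: f_def)
    have fresh2: "snd (f j) \<notin> Range G" for j
      using matching_prefix[OF matching_converse[OF G(1)], of "p' @ [(c, \<tau>', m')]" "take j r"] m'(2)
      by (auto simp: f_def)
    have inj: "fst (f j) = fst (f l) \<longleftrightarrow> snd (f j) = snd (f l)" for j l
      by (simp add: f_def)
    have step: "(butlast (fst (f j)), butlast (snd (f j))) \<in> G' \<and>
        fst (last (fst (f j))) = fst (last (snd (f j)))" if j: "j \<le> length r" for j
    proof (cases j)
      case 0
      then show ?thesis using p' x by (simp add: f_def G'_def butlast_append)
    next
      case (Suc l)
      then have "take j r \<noteq> []" "butlast (take j r) = take l r"
        using j by (auto simp: butlast_take)
      then have "(butlast (fst (f j)), butlast (snd (f j))) = f l"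
        by (simp add: f_def butlast_append)
      then show ?thesis using Suc j \<open>take j r \<noteq> []\<close> by (auto simp: G'_def f_def)
    qed
    have match: "matching M w t\<^sub>1 t\<^sub>2 G'"
    proof -
      have "valid M w t\<^sub>1 u \<and> valid M w t\<^sub>2 u' \<and> length u = length u' \<and>
        (u \<noteq> [] \<longrightarrow> (butlast u, butlast u') \<in> G' \<and> fst (last u) = fst (last u'))"
        if u: "(u, u') \<in> G'" for u u'
      proof (cases "(u, u') \<in> G")
        case True
        then show ?thesis using G(1) unfolding matching_def G'_def by blast
      next
        case False
        then obtain j where j: "j \<le> length r" "f j = (u, u')" using u by (auto simp: G'_def)
        then show ?thesis using vf1[of j] vf2[of j] step[of j] len by (auto simp: f_def)
      qed
      moreover have "u = z \<longleftrightarrow> u' = z'" if uz: "(u, u') \<in> G'" "(z, z') \<in> G'" for u u' z z'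
      proof -
        have new: "\<exists>j. y = fst (f j) \<and> y' = snd (f j)" if y: "(y, y') \<in> G'" "(y, y') \<notin> G" for y y'
        proof -
          obtain j where "f j = (y, y')" using y by (auto simp: G'_def)
          then show ?thesis by (intro exI[of _ j]) auto
        qed
        have old_new: "y \<noteq> fst (f j) \<and> y' \<noteq> snd (f j)" if "(y, y') \<in> G" for j y y'
          using that fresh1[of j] fresh2[of j] by blast
        show ?thesis
        proof (cases "(u, u') \<in> G")
          case u: True
          show ?thesis
          proof (cases "(z, z') \<in> G")
            case True
            with u show ?thesis by (rule matchingD(6)[OF G(1)])
          next
            case False
            then show ?thesis using new[OF uz(2)] old_new[OF u] by metis
          qed
        next
          case False
          then obtain j where j: "u = fst (f j)" "u' = snd (f j)" using new[OF uz(1)] by auto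
          show ?thesis
          proof (cases "(z, z') \<in> G")
            case True
            then show ?thesis using old_new[OF True] j by metis
          next
            case False
            then obtain l where "z = fst (f l)" "z' = snd (f l)" using new[OF uz(2)] by auto
            then show ?thesis using inj j by simp
          qed
        qed
      qed
      moreover have "([], []) \<in> G'" using G(1) by (auto simp: matching_def G'_def)
      ultimately show ?thesis unfolding matching_def by fast
    qed
    have tolG': "tolerable g (length \<sigma>') w t\<^sub>1 t\<^sub>2 G'"
    proof -
      have "good (drop (length u) w) (ntype t\<^sub>1 u) = g \<and>
        good (drop (length u) w) (ntype t\<^sub>2 u') = (\<not> g) \<and> length \<sigma>' + length u \<le> length w"
        if u: "(u, u') \<in> G'" "ntype t\<^sub>1 u \<noteq> ntype t\<^sub>2 u'" for u u'
      proof (cases "(u, u') \<in> G")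
        case True
        then show ?thesis using tol' u(2) unfolding tolerable_def by blast
      next
        case False
        then obtain j where j: "f j = (u, u')" using u by (auto simp: G'_def)
        then have "take j r = []" using u(2) by (auto simp: f_def ntype_def split: if_splits)
        then have "u = p @ [x]" "u' = p' @ [(c, \<tau>', m')]" using j by (auto simp: f_def)
        then show ?thesis using \<tau>' u(2) x v by (auto simp: cont_def i_def)
      qed
      then show ?thesis unfolding tolerable_def by blast
    qed
    have "a = fst (f (length r))" using ps(1) Cons by (simp add: f_def)
    then have "(a, snd (f (length r))) \<in> G'" by (auto simp: G'_def)
    moreover have "card G' \<le> card G + length w"
    proof -
      have "card G' \<le> card G + card (f ` {..length r})" unfolding G'_def by (rule card_Un_le)
      moreover have "card (f ` {..length r}) \<le> Suc (length r)"
        using card_image_le[of "{..length r}" f] by simp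
      moreover have "Suc (length r) \<le> length w"
        using valid_length[OF a] ps(1) Cons by simp
      ultimately show ?thesis by linarith
    qed
    moreover have "finite G'" "G \<subseteq> G'" using G(2) by (auto simp: G'_def)
    ultimately show ?thesis using match tolG' unfolding \<sigma>'_def by blast
  qed
qed

section \<open>Transfer of sentences along matchings\<close>

fun qdepth :: "fm \<Rightarrow> nat" where
  "qdepth (Pos a) = 0"
| "qdepth (Neg a) = 0"
| "qdepth (Conj \<phi> \<psi>) = max (qdepth \<phi>) (qdepth \<psi>)"
| "qdepth (Disj \<phi> \<psi>) = max (qdepth \<phi>) (qdepth \<psi>)"
| "qdepth (Exist x \<phi>) = Suc (qdepth \<phi>)"
| "qdepth (Forall x \<phi>) = Suc (qdepth \<phi>)"

text \<open>Parents of matched nodes are matched, and a matching is injective both ways, so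
  adjacency and side are preserved and reflected.\<close>

lemma matching_child:
  assumes G: "matching M w t\<^sub>1 t\<^sub>2 G" and "(p, p') \<in> G" "(r, r') \<in> G"
  shows "(\<exists>x. r = p @ [x] \<and> fst x = c) \<longleftrightarrow> (\<exists>x. r' = p' @ [x] \<and> fst x = c)"
proof -
  have *: "\<exists>x. r' = p' @ [x] \<and> fst x = c"
    if "matching M w t\<^sub>1 t\<^sub>2 G" "(p, p') \<in> G" "(r, r') \<in> G" "r = p @ [x]" "fst x = c"
    for t\<^sub>1 t\<^sub>2 G p p' r r' x
  proof -
    have "(butlast r, butlast r') \<in> G" "fst (last r) = fst (last r')" "length r = length r'"
      using matchingD(3-5)[OF that(1,3)] that(4) by auto
    moreover have "butlast r = p" using that(4) by simp
    moreover have "butlast r' = p'"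
      using matchingD(6)[OF that(1) calculation(1) that(2)] calculation(4) by simp
    moreover have "r' \<noteq> []" using calculation(3) that(4) by auto
    ultimately show ?thesis using that(4,5) append_butlast_last_id[of r']
      by (intro exI[of _ "last r'"]) auto
  qed
  show ?thesis
    using *[OF G assms(2,3)] *[OF matching_converse[OF G], of p' p r' r] assms(2,3) by blast
qed

text \<open>Only \<open>U\<close> could reveal a mismatch, and only at full depth; there the depth
  bound fails because \<open>n > 0\<close>.\<close>

lemma matching_atom:
  assumes G: "matching M w t\<^sub>1 t\<^sub>2 G" and tol: "tolerable True n w t\<^sub>1 t\<^sub>2 G" and "n > 0"
    and e: "\<And>x. Var x \<in> trms at \<Longrightarrow> (e\<^sub>1 x, e\<^sub>2 x) \<in> G"
  shows "sat_atom (tree M w t\<^sub>1) e\<^sub>1 at \<longleftrightarrow> sat_atom (tree M w t\<^sub>2) e\<^sub>2 at"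
proof -
  have ev: "(eval_trm (tree M w t\<^sub>1) e\<^sub>1 s, eval_trm (tree M w t\<^sub>2) e\<^sub>2 s) \<in> G" if "s \<in> trms at" for s
    using e G that by (cases s) (auto simp: matching_def)
  have val: "valid M w t\<^sub>1 p" "valid M w t\<^sub>2 p'" "length p = length p'" if "(p, p') \<in> G" for p p'
    using G that unfolding matching_def by blast+
  show ?thesis
  proof (cases at)
    case (Eq s u)
    then show ?thesis using ev[of s] ev[of u] G unfolding matching_def by auto
  next
    case (UAtom s)
    let ?p = "eval_trm (tree M w t\<^sub>1) e\<^sub>1 s" and ?p' = "eval_trm (tree M w t\<^sub>2) e\<^sub>2 s"
    have G: "(?p, ?p') \<in> G" using UAtom ev by simp
    then have "ntype t\<^sub>1 ?p \<noteq> ntype t\<^sub>2 ?p' \<longrightarrow> n + length ?p \<le> length w"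
      using tol unfolding tolerable_def by blast
    then have "ntype t\<^sub>1 ?p = ntype t\<^sub>2 ?p'" if "length ?p = length w" using \<open>n > 0\<close> that by auto
    then show ?thesis using UAtom val[OF G] by auto
  next
    case (RAtom s u)
    then show ?thesis using ev[of s] ev[of u] val matching_child[OF G ev[of s] ev[of u], of True]
      by auto
  next
    case (BAtom s u)
    then show ?thesis using ev[of s] ev[of u] val matching_child[OF G ev[of s] ev[of u], of False]
      by auto
  qed
qed

text \<open>Induction on \<theta>, with \<sigma> the unread suffix of \<open>w\<close>. An \<exists>
  is answered by extending the matching, a \<forall> by extending its converse with the flag
  reversed. Each pick adds at most \<open>length w\<close> pairs, so the bound on \<open>M\<close>
  leaves copies for the remaining \<open>qdepth \<theta>\<close> picks.\<close>

lemma matching_sat: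
  assumes "avoids \<sigma> \<theta>" "\<sigma> = drop k w" "\<sigma> \<noteq> []"
    and "matching M w t\<^sub>1 t\<^sub>2 G" "tolerable True (length \<sigma>) w t\<^sub>1 t\<^sub>2 G"
    and "finite G" "card G + qdepth \<theta> * length w < M"
    and "\<And>x. x \<in> fv \<theta> \<Longrightarrow> (e\<^sub>1 x, e\<^sub>2 x) \<in> G"
    and "sat (tree M w t\<^sub>1) e\<^sub>1 \<theta>"
  shows "sat (tree M w t\<^sub>2) e\<^sub>2 \<theta>"
  using assms
proof (induction \<theta> arbitrary: \<sigma> k G e\<^sub>1 e\<^sub>2)
  case (Pos a)
  then show ?case using matching_atom[of M w t\<^sub>1 t\<^sub>2 G "length \<sigma>" a e\<^sub>1 e\<^sub>2] by simp
next
  case (Neg a)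
  then show ?case using matching_atom[of M w t\<^sub>1 t\<^sub>2 G "length \<sigma>" a e\<^sub>1 e\<^sub>2] by simp
next
  case (Conj \<phi> \<psi>)
  have "qdepth \<phi> * length w \<le> qdepth (Conj \<phi> \<psi>) * length w"
    "qdepth \<psi> * length w \<le> qdepth (Conj \<phi> \<psi>) * length w" by auto
  then have "card G + qdepth \<phi> * length w < M" "card G + qdepth \<psi> * length w < M"
    using Conj.prems(7) by linarith+
  then show ?case
    using Conj.IH(1)[of \<sigma> k G e\<^sub>1 e\<^sub>2] Conj.IH(2)[of \<sigma> k G e\<^sub>1 e\<^sub>2] Conj.prems by simp
next
  case (Disj \<phi> \<psi>)
  have "qdepth \<phi> * length w \<le> qdepth (Disj \<phi> \<psi>) * length w"
    "qdepth \<psi> * length w \<le> qdepth (Disj \<phi> \<psi>) * length w" by auto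
  then have "card G + qdepth \<phi> * length w < M" "card G + qdepth \<psi> * length w < M"
    using Disj.prems(7) by linarith+
  then show ?case
    using Disj.IH(1)[of \<sigma> k G e\<^sub>1 e\<^sub>2] Disj.IH(2)[of \<sigma> k G e\<^sub>1 e\<^sub>2] Disj.prems by auto
next
  case (Exist x \<phi>)
  let ?\<sigma> = "spent QExists \<sigma>"
  have av: "avoids ?\<sigma> \<phi>" "?\<sigma> \<noteq> []"
    using Exist.prems(1,3) by (auto simp: spent_def split: if_splits)
  obtain k' where k': "?\<sigma> = drop k' w"
    using Exist.prems(2) by (metis drop_Suc spent_def tl_drop)
  obtain a where a: "valid M w t\<^sub>1 a" "sat (tree M w t\<^sub>1) (e\<^sub>1(x := a)) \<phi>"
    using Exist.prems(9) by auto
  have c: "card G < M" using Exist.prems(7) by linarith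
  obtain G' a' where G': "G \<subseteq> G'" "(a, a') \<in> G'" "matching M w t\<^sub>1 t\<^sub>2 G'" "finite G'"
    "card G' \<le> card G + length w" "tolerable True (length ?\<sigma>) w t\<^sub>1 t\<^sub>2 G'"
    using matching_extend[of M w t\<^sub>1 t\<^sub>2 G True \<sigma> k a] Exist.prems c a(1) av(2) by auto
  have "sat (tree M w t\<^sub>2) (e\<^sub>2(x := a')) \<phi>"
  proof (rule Exist.IH[OF av(1) k' av(2) G'(3,6,4) _ _ a(2)])
    show "card G' + qdepth \<phi> * length w < M" using G'(5) Exist.prems(7) by simp
    show "((e\<^sub>1(x := a)) y, (e\<^sub>2(x := a')) y) \<in> G'" if "y \<in> fv \<phi>" for y
      using that G'(1,2) Exist.prems(8) by auto
  qed
  moreover have "valid M w t\<^sub>2 a'" using G'(2,3) unfolding matching_def by blast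
  ultimately show ?case by auto
next
  case (Forall x \<phi>)
  let ?\<sigma> = "spent QForall \<sigma>"
  have av: "avoids ?\<sigma> \<phi>" "?\<sigma> \<noteq> []"
    using Forall.prems(1,3) by (auto simp: spent_def split: if_splits)
  obtain k' where k': "?\<sigma> = drop k' w"
    using Forall.prems(2) by (metis drop_Suc spent_def tl_drop)
  have c: "card (G\<inverse>) < M" using Forall.prems(7) by simp
  have "sat (tree M w t\<^sub>2) (e\<^sub>2(x := a')) \<phi>" if a': "valid M w t\<^sub>2 a'" for a'
  proof -
    have "tolerable False (length \<sigma>) w t\<^sub>2 t\<^sub>1 (G\<inverse>)"
      using tolerable_converse[OF Forall.prems(4,5)] by simp
    then obtain H a where H: "G\<inverse> \<subseteq> H" "(a', a) \<in> H" "matching M w t\<^sub>2 t\<^sub>1 H" "finite H"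
      "card H \<le> card G + length w" "tolerable False (length ?\<sigma>) w t\<^sub>2 t\<^sub>1 H"
      using matching_extend[of M w t\<^sub>2 t\<^sub>1 "G\<inverse>" False \<sigma> k a'] matching_converse[OF Forall.prems(4)]
        Forall.prems c a' av(2) by auto
    have G': "matching M w t\<^sub>1 t\<^sub>2 (H\<inverse>)" "tolerable True (length ?\<sigma>) w t\<^sub>1 t\<^sub>2 (H\<inverse>)"
      using matching_converse[OF H(3)] tolerable_converse[OF H(3,6)] by auto
    have "valid M w t\<^sub>1 a" using H(2,3) unfolding matching_def by blast
    then have "sat (tree M w t\<^sub>1) (e\<^sub>1(x := a)) \<phi>" using Forall.prems(9) by simp
    show ?thesis
    proof (rule Forall.IH[OF av(1) k' av(2) G' _ _ _ \<open>sat _ _ \<phi>\<close>])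
      show "finite (H\<inverse>)" using H(4) by simp
      show "card (H\<inverse>) + qdepth \<phi> * length w < M" using H(5) Forall.prems(7) by simp
      show "((e\<^sub>1(x := a)) y, (e\<^sub>2(x := a')) y) \<in> H\<inverse>" if "y \<in> fv \<phi>" for y
        using that H(1,2) Forall.prems(8) by auto
    qed
  qed
  then show ?case by simp
qed

section \<open>Isomorphism invariance\<close>

text \<open>Unlike \<open>isomorphic\<close>, this names the map and allows two carrier types, as
  needed to move the trees from addresses to \<open>nat\<close>.\<close>

definition iso_via :: "('a \<Rightarrow> 'b) \<Rightarrow> 'a struct \<Rightarrow> 'b struct \<Rightarrow> bool" where
  "iso_via h A B \<longleftrightarrow> bij_betw h (universe A) (universe B) \<and>
     (\<forall>x \<in> universe A. x \<in> relU A \<longleftrightarrow> h x \<in> relU B) \<and>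
     (\<forall>x \<in> universe A. \<forall>y \<in> universe A. (x, y) \<in> relR A \<longleftrightarrow> (h x, h y) \<in> relR B) \<and>
     (\<forall>x \<in> universe A. \<forall>y \<in> universe A. (x, y) \<in> relB A \<longleftrightarrow> (h x, h y) \<in> relB B) \<and>
     h (cstr A) = cstr B"

lemma sat_atom_iso:
  assumes iso: "iso_via h A B" and c: "cstr A \<in> universe A" and e: "\<And>x. e x \<in> universe A"
  shows "sat_atom A e a \<longleftrightarrow> sat_atom B (\<lambda>x. h (e x)) a"
proof -
  have "eval_trm B (\<lambda>x. h (e x)) t = h (eval_trm A e t)" "eval_trm A e t \<in> universe A" for t
    using iso c e by (cases t; auto simp: iso_via_def)+
  then show ?thesis using iso by (cases a) (auto simp: iso_via_def bij_betw_def inj_on_def)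
qed

lemma sat_iso:
  assumes iso: "iso_via h A B" and c: "cstr A \<in> universe A"
  shows "(\<And>x. e x \<in> universe A) \<Longrightarrow> sat A e \<theta> \<longleftrightarrow> sat B (\<lambda>x. h (e x)) \<theta>"
proof (induction \<theta> arbitrary: e)
  case (Pos a)
  then show ?case using sat_atom_iso[OF iso c, of e a] by simp
next
  case (Neg a)
  then show ?case using sat_atom_iso[OF iso c, of e a] by simp
next
  case (Exist x \<theta>)
  have im: "universe B = h ` universe A" using iso by (simp add: iso_via_def bij_betw_def)
  have "sat A (e(x := a)) \<theta> \<longleftrightarrow> sat B ((\<lambda>x. h (e x))(x := h a)) \<theta>" if "a \<in> universe A" for a
    using Exist.IH[of "e(x := a)"] Exist.prems that by (simp add: fun_upd_def if_distrib)
  then show ?case by (simp add: im)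
next
  case (Forall x \<theta>)
  have im: "universe B = h ` universe A" using iso by (simp add: iso_via_def bij_betw_def)
  have "sat A (e(x := a)) \<theta> \<longleftrightarrow> sat B ((\<lambda>x. h (e x))(x := h a)) \<theta>" if "a \<in> universe A" for a
    using Forall.IH[of "e(x := a)"] Forall.prems that by (simp add: fun_upd_def if_distrib)
  then show ?case by (simp add: im)
qed auto

lemma sat_cong: "(\<And>x. x \<in> fv \<theta> \<Longrightarrow> e x = e' x) \<Longrightarrow> sat A e \<theta> \<longleftrightarrow> sat A e' \<theta>"
proof (induction \<theta> arbitrary: e e')
  case (Pos a)
  have "eval_trm A e t = eval_trm A e' t" if "t \<in> trms a" for t using Pos that by (cases t) auto
  then show ?case by (cases a) auto
next
  case (Neg a)
  have "eval_trm A e t = eval_trm A e' t" if "t \<in> trms a" for t using Neg that by (cases t) auto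
  then show ?case by (cases a) auto
next
  case (Conj \<phi> \<psi>)
  then show ?case by (metis UnCI fv.simps(3) sat.simps(3))
next
  case (Disj \<phi> \<psi>)
  then show ?case by (metis UnCI fv.simps(4) sat.simps(4))
next
  case (Exist x \<theta>)
  have "sat A (e(x := a)) \<theta> \<longleftrightarrow> sat A (e'(x := a)) \<theta>" for a
    using Exist.prems by (intro Exist.IH) auto
  then show ?case by simp
next
  case (Forall x \<theta>)
  have "sat A (e(x := a)) \<theta> \<longleftrightarrow> sat A (e'(x := a)) \<theta>" for a
    using Forall.prems by (intro Forall.IH) auto
  then show ?case by simp
qed

lemma models_iff_sat:
  assumes "sentence \<theta>" "\<And>x. e x \<in> universe A"
  shows "A \<Turnstile> \<theta> \<longleftrightarrow> sat A e \<theta>"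
  using assms sat_cong[of \<theta>] unfolding models_def sentence_def by (metis empty_iff)

lemma models_iso:
  assumes "iso_via h A B" "cstr A \<in> universe A" "sentence \<theta>"
  shows "A \<Turnstile> \<theta> \<longleftrightarrow> B \<Turnstile> \<theta>"
proof -
  have "h (cstr A) \<in> universe B" using assms(1,2) by (metis iso_via_def bij_betwE)
  then show ?thesis
    using sat_iso[OF assms(1,2), of "\<lambda>_. cstr A" \<theta>] assms(2,3)
      models_iff_sat[of \<theta> "\<lambda>_. cstr A" A] models_iff_sat[of \<theta> "\<lambda>_. h (cstr A)" B] by simp
qed

lemma is_property_models:
  assumes "sentence \<theta>"
  shows "is_property finite_structures {A \<in> finite_structures. A \<Turnstile> \<theta>}"
  unfolding is_property_def
proof (intro conjI ballI impI)
  fix A B :: "'a struct"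
  assume A: "A \<in> {A \<in> finite_structures. A \<Turnstile> \<theta>}" and B: "B \<in> finite_structures"
    and "isomorphic A B"
  then obtain h where "iso_via h A B" unfolding isomorphic_def iso_via_def by blast
  then show "B \<in> {A \<in> finite_structures. A \<Turnstile> \<theta>}"
    using models_iso[of h A B \<theta>] A B assms by (auto simp: finite_structures_def is_structure_def)
qed auto

section \<open>Transport to the natural numbers and conclusion\<close>

definition image_struct :: "('a \<Rightarrow> 'b) \<Rightarrow> 'a struct \<Rightarrow> 'b struct" where
  "image_struct h A = \<lparr>universe = h ` universe A, relU = h ` relU A,
     relR = map_prod h h ` relR A, relB = map_prod h h ` relB A, cstr = h (cstr A)\<rparr>"

lemma image_struct:
  assumes "inj h" "A \<in> finite_structures"
  shows "image_struct h A \<in> finite_structures" "iso_via h A (image_struct h A)"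
proof -
  show "image_struct h A \<in> finite_structures"
    using assms(2) by (auto simp: finite_structures_def is_structure_def image_struct_def)
  have "(x, y) \<in> r \<longleftrightarrow> (h x, h y) \<in> map_prod h h ` r" for x y r
    using assms(1) by (auto simp: inj_eq)
  then show "iso_via h A (image_struct h A)"
    using assms(1) by (auto simp: iso_via_def image_struct_def inj_image_mem_iff
      intro: inj_on_subset inj_on_imp_bij_betw)
qed

text \<open>The trees with a good and a bad root are compared, starting from the matching of the two
  roots with all of \<open>w\<close> unread: a mismatch at depth 0 is tolerable then.\<close>

lemma game_fm_not_equivalent:
  assumes w: "w \<noteq> []" and \<theta>: "sentence \<theta>" "avoids w \<theta>"
  shows "\<exists>(A :: nat struct) (B :: nat struct). A \<in> finite_structures \<and> B \<in> finite_structures \<and>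
    A \<Turnstile> game_fm w Root 0 \<and> \<not> B \<Turnstile> game_fm w Root 0 \<and> (A \<Turnstile> \<theta> \<longrightarrow> B \<Turnstile> \<theta>)"
proof -
  \<comment> \<open>One pair at the start, at most \<open>length w\<close> more per nested
    quantifier, and one because the bound is strict.\<close>
  define M where "M = Suc (Suc (qdepth \<theta> * length w))"
  obtain g b where gb: "good w g" "\<not> good w b" using ex_good[of w] by metis
  define A where "A = image_struct (to_nat :: address \<Rightarrow> nat) (tree M w g)"
  define B where "B = image_struct (to_nat :: address \<Rightarrow> nat) (tree M w b)"
  have fin: "A \<in> finite_structures" "B \<in> finite_structures"
    unfolding A_def B_def by (auto intro: image_struct tree_finite_structure)
  have A: "A \<Turnstile> \<psi> \<longleftrightarrow> sat (tree M w g) (\<lambda>_. []) \<psi>" and B: "B \<Turnstile> \<psi> \<longleftrightarrow> sat (tree M w b) (\<lambda>_. []) \<psi>"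
    if "sentence \<psi>" for \<psi>
    unfolding A_def B_def
    using models_iso[OF image_struct(2)[OF inj_to_nat tree_finite_structure], where \<theta> = \<psi>] that
      models_iff_sat[of \<psi> "\<lambda>_. []" "tree M w _"] by auto
  have root: "sat (tree M w t) (\<lambda>_. []) (game_fm w Root 0) \<longleftrightarrow> good w t" for t
    using sat_game_fm[where p = "[]" and v = w and e = "\<lambda>_. []" and t = Root and k = 0]
    by (simp add: M_def)
  have "A \<Turnstile> game_fm w Root 0" "\<not> B \<Turnstile> game_fm w Root 0"
    using A[OF sentence_game_fm] B[OF sentence_game_fm] gb root by simp_all
  moreover have "sat (tree M w b) (\<lambda>_. []) \<theta>" if "sat (tree M w g) (\<lambda>_. []) \<theta>"
  proof (rule matching_sat[OF \<theta>(2) _ w _ _ _ _ _ that])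
    show "w = drop 0 w" by simp
    show "matching M w g b {([], [])}" by (auto simp: matching_def)
    show "tolerable True (length w) w g b {([], [])}" using gb by (auto simp: tolerable_def)
  qed (use \<theta>(1) in \<open>auto simp: M_def sentence_def\<close>)
  ultimately show ?thesis using fin A[OF \<theta>(1)] B[OF \<theta>(1)] by blast
qed

text \<open>The empty word lies in \<open>words T\<close> as soon as \<open>T\<close> has a path. If
  it separates, \<open>words T\<close> is empty, and the full label word of any path of
  \<open>S\<close> separates too.\<close>

lemma nonempty_separating_word:
  assumes "\<not> words S \<subseteq> words T"
  obtains w where "w \<in> words S" "w \<notin> words T" "w \<noteq> []"
proof -
  obtain w where w: "w \<in> words S" "w \<notin> words T" using assms by blast
  show thesis
  proof (cases "w = []")
    case True
    then have "words T = {}" using w(2) by (auto simp: words_def)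
    moreover obtain vs where vs: "dipath S vs" using w(1) by (auto simp: words_def)
    then have "map (label S) vs \<in> words S" by (auto simp: words_def)
    moreover have "map (label S) vs \<noteq> []" using vs by (auto simp: dipath_def)
    ultimately show thesis using that by blast
  qed (use w that in blast)
qed

theorem theorem3p23:
  fixes S\<^sub>1 S\<^sub>2 :: forest
  assumes "\<not> words S\<^sub>1 \<subseteq> words S\<^sub>2"
  shows "\<not> FO finite_tau_structures S\<^sub>1 \<subseteq> FO finite_tau_structures S\<^sub>2"
proof
  assume sub: "FO finite_tau_structures S\<^sub>1 \<subseteq> FO finite_tau_structures S\<^sub>2"
  obtain w where w: "w \<in> words S\<^sub>1" "w \<notin> words S\<^sub>2" "w \<noteq> []"
    using assms by (rule nonempty_separating_word)
  let ?K = "{A \<in> finite_tau_structures. A \<Turnstile> game_fm w Root 0}"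
  have "?K \<in> FO finite_tau_structures S\<^sub>1"
    unfolding FO_def using is_property_models[OF sentence_game_fm] sentence_game_fm game_fm_emb[OF w(1)] by blast
  then obtain \<theta> where \<theta>: "sentence \<theta>" "qs \<theta> \<preceq>\<^sub>e S\<^sub>2"
    "?K = {A \<in> finite_tau_structures. A \<Turnstile> \<theta>}"
    using sub unfolding FO_def by blast
  then obtain A B :: "nat struct" where "A \<in> finite_structures" "B \<in> finite_structures"
    "A \<Turnstile> game_fm w Root 0" "\<not> B \<Turnstile> game_fm w Root 0" "A \<Turnstile> \<theta> \<longrightarrow> B \<Turnstile> \<theta>"
    using game_fm_not_equivalent[OF w(3) \<theta>(1) emb_avoids[OF \<theta>(2) w(3,2)]] by blast
  then show False using \<theta>(3) by blast
qed

end
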